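(* Let $\omega$ and $v$ be discrete weights on $\mathbb{Z}$. (i) Let $1\le p\le q<\infty$ and suppose there is a constant $C>0$ such that $\omega(k)\le C v(k)$ for every $k\in\mathbb{Z}$. Then $l^p_{q\,(v,\omega)}\subseteq l^p_{q\,(\omega,v)}$, and there is a constant $C'>0$, independent of $x$, such that $\|x\|_{l^p_{q\,(\omega,v)}}\le C'\|x\|_{l^p_{q\,(v,\omega)}}$ for every $x\in l^p_{q\,(v,\omega)}$. (ii) If $1\le p<\infty$, then $l^\infty\subseteq l^p_{\infty\,(\omega)}$, with $\|x\|_{l^p_{\infty\,(\omega)}}\le\|x\|_{l^\infty}$ for every $x\in l^\infty$. (iii) If $1<p<q<\infty$, then $l^q_\omega\subseteq l^p_{q\,(\omega)}$, with $\|x\|_{l^p_{q\,(\omega)}}\le\|x\|_{l^q_\omega}$ for every $x\in l^q_\omega$.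
   Context: A discrete weight on $\mathbb{Z}$ is a sequence $\omega=\{\omega(k)\}_{k\in\mathbb{Z}}$ of positive real numbers; for a finite set $S\subset\mathbb{Z}$, $\omega(S):=\sum_{k\in S}\omega(k)$. Let $\mathbb{N}=\{0,1,2,\dots\}$ and, for $m\in\mathbb{Z}$, $N\in\mathbb{N}$, $S_{m,N}:=\{k\in\mathbb{Z}:|k-m|\le N\}$. For $1\le p\le q<\infty$ and discrete weights $\omega,v$, the discrete weighted Morrey space $l^p_{q\,(\omega,v)}$ is the set of real sequences $x=\{x(k)\}_{k\in\mathbb{Z}}$ with $$\|x\|_{l^p_{q\,(\omega,v)}}:=\sup_{m\in\mathbb{Z},N\in\mathbb{N}} v(S_{m,N})^{\frac1q-\frac1p}\Big(\sum_{k\in S_{m,N}}|x(k)|^p\omega(k)\Big)^{1/p}<\infty.$$ In $l^p_{q\,(v,\omega)}$ the roles of $\omega$ and $v$ are exchanged. When $v=\omega$ write $l^p_{q\,(\omega)}:=l^p_{q\,(\omega,\omega)}$. For $1\le p<q=\infty$, $l^p_{\infty\,(\omega)}$ is the set of real sequences with $\|x\|_{l^p_{\infty\,(\omega)}}:=\sup_{m\in\mathbb{Z},N\in\mathbb{N}}\omega(S_{m,N})^{-1/p}\big(\sum_{k\in S_{m,N}}|x(k)|^p\omega(k)\big)^{1/p}<\infty$. $l^\infty$ is the space of bounded real sequences on $\mathbb{Z}$ with the supremum norm, and $l^q_\omega$ is the space of real sequences with $\|x\|_{l^q_\omega}:=\big(\sum_{k\in\mathbb{Z}}|x(k)|^q\omega(k)\big)^{1/q}<\infty$.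 *)

theory Defs
  imports "HOL-Analysis.Analysis"
begin

definition discrete_weight :: "(int \<Rightarrow> real) \<Rightarrow> bool" where
  "discrete_weight w \<longleftrightarrow> (\<forall>k. 0 < w k)"

definition sym_interval :: "int \<Rightarrow> nat \<Rightarrow> int set" where
  "sym_interval m N = {k. \<bar>k - m\<bar> \<le> int N}"

lemma sym_interval_eq: "sym_interval m N = {m - int N..m + int N}"
  by (auto simp: sym_interval_def)

lemma finite_sym_interval [simp]: "finite (sym_interval m N)"
  by (simp add: sym_interval_eq)

text \<open>
  All norms below are real-valued suprema or sums. Finiteness of the norm is expressed by
  boundedness or summability in the definition of the corresponding space; outside that space
  the value of the norm is meaningless.

  In the two-weight spaces the first weight sits inside the sum over the values of the sequence and
  the second one is the weight of the interval.
\<close>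

definition morrey_term ::
  "real \<Rightarrow> real \<Rightarrow> (int \<Rightarrow> real) \<Rightarrow> (int \<Rightarrow> real) \<Rightarrow> (int \<Rightarrow> real) \<Rightarrow> int \<times> nat \<Rightarrow> real" where
  "morrey_term p q \<omega> v x = (\<lambda>(m, N).
     (\<Sum>k\<in>sym_interval m N. v k) powr (1 / q - 1 / p)
       * (\<Sum>k\<in>sym_interval m N. \<bar>x k\<bar> powr p * \<omega> k) powr (1 / p))"

definition morrey_space ::
  "real \<Rightarrow> real \<Rightarrow> (int \<Rightarrow> real) \<Rightarrow> (int \<Rightarrow> real) \<Rightarrow> (int \<Rightarrow> real) set" where
  "morrey_space p q \<omega> v = {x. bdd_above (range (morrey_term p q \<omega> v x))}"

definition morrey_norm ::
  "real \<Rightarrow> real \<Rightarrow> (int \<Rightarrow> real) \<Rightarrow> (int \<Rightarrow> real) \<Rightarrow> (int \<Rightarrow> real) \<Rightarrow> real" where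
  "morrey_norm p q \<omega> v x = (SUP i. morrey_term p q \<omega> v x i)"

text \<open>The endpoint \<open>q = \<infinity>\<close>, where \<open>1/q\<close> is read as \<open>0\<close> and both weights agree.\<close>

definition morrey_infty_term ::
  "real \<Rightarrow> (int \<Rightarrow> real) \<Rightarrow> (int \<Rightarrow> real) \<Rightarrow> int \<times> nat \<Rightarrow> real" where
  "morrey_infty_term p \<omega> x = (\<lambda>(m, N).
     (\<Sum>k\<in>sym_interval m N. \<omega> k) powr (- 1 / p)
       * (\<Sum>k\<in>sym_interval m N. \<bar>x k\<bar> powr p * \<omega> k) powr (1 / p))"

definition morrey_infty_space :: "real \<Rightarrow> (int \<Rightarrow> real) \<Rightarrow> (int \<Rightarrow> real) set" where
  "morrey_infty_space p \<omega> = {x. bdd_above (range (morrey_infty_term p \<omega> x))}"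

definition morrey_infty_norm :: "real \<Rightarrow> (int \<Rightarrow> real) \<Rightarrow> (int \<Rightarrow> real) \<Rightarrow> real" where
  "morrey_infty_norm p \<omega> x = (SUP i. morrey_infty_term p \<omega> x i)"

definition linfty_space :: "(int \<Rightarrow> real) set" where
  "linfty_space = {x. bounded (range x)}"

definition linfty_norm :: "(int \<Rightarrow> real) \<Rightarrow> real" where
  "linfty_norm x = (SUP k. \<bar>x k\<bar>)"

definition lq_space :: "real \<Rightarrow> (int \<Rightarrow> real) \<Rightarrow> (int \<Rightarrow> real) set" where
  "lq_space q \<omega> = {x. (\<lambda>k. \<bar>x k\<bar> powr q * \<omega> k) summable_on UNIV}"

definition lq_norm :: "real \<Rightarrow> (int \<Rightarrow> real) \<Rightarrow> (int \<Rightarrow> real) \<Rightarrow> real" where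
  "lq_norm q \<omega> x = (\<Sum>\<^sub>\<infinity>k. \<bar>x k\<bar> powr q * \<omega> k) powr (1 / q)"

end

theory Submission
  imports Defs
begin

text \<open>
  All three inclusions hold term by term, so that only the supremum remains to be taken. In (i), the
  exponent \<open>1/q - 1/p\<close> is nonpositive, hence exchanging the weights costs \<open>C\<close> to the power
  \<open>1/p - 1/q\<close> for the weight of the interval and \<open>C\<close> to the power \<open>1/p\<close> for the weighted sum.
  In (iii), each Morrey term is \<open>W\<close> to the power \<open>1/q\<close> times the weighted \<open>p\<close>-mean of \<open>x\<close> over
  an interval of weight \<open>W\<close>, and the \<open>p\<close>-mean is at most the \<open>q\<close>-mean.
\<close>

lemma sym_interval_nonempty [simp]: "sym_interval m N \<noteq> {}"
  by (simp add: sym_interval_eq)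

lemma discrete_weight_sum_pos:
  assumes "discrete_weight w"
  shows "0 < (\<Sum>k\<in>sym_interval m N. w k)"
  using assms by (intro sum_pos) (auto simp: discrete_weight_def)

lemma weighted_sum_nonneg:
  assumes "discrete_weight w"
  shows "0 \<le> (\<Sum>k\<in>A. \<bar>x k\<bar> powr p * w k)"
  using assms by (intro sum_nonneg mult_nonneg_nonneg) (auto simp: discrete_weight_def less_imp_le)

text \<open>Jensen's inequality for the convex function \<open>t powr r\<close> and the probability
  weights \<open>w k / W\<close>: average over \<open>S\<close> the tangent line at the mean
  \<open>M\<close>, which lies below the function.\<close>

lemma weighted_power_mean:
  fixes a w :: "'a \<Rightarrow> real"
  assumes r: "1 < r" and a: "\<And>k. k \<in> S \<Longrightarrow> 0 \<le> a k" and w: "\<And>k. k \<in> S \<Longrightarrow> 0 \<le> w k"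
    and W: "0 < (\<Sum>k\<in>S. w k)"
  shows "(\<Sum>k\<in>S. w k) * ((\<Sum>k\<in>S. a k * w k) / (\<Sum>k\<in>S. w k)) powr r \<le> (\<Sum>k\<in>S. a k powr r * w k)"
proof -
  define W M where "W = (\<Sum>k\<in>S. w k)" and "M = (\<Sum>k\<in>S. a k * w k) / W"
  have "0 < W" using W by (simp add: W_def)
  have "0 \<le> M"
    unfolding M_def using \<open>0 < W\<close> a w by (intro divide_nonneg_pos sum_nonneg) auto
  \<comment> \<open>Young's inequality for \<open>y\<close> and \<open>M powr (r - 1)\<close> with
    conjugate exponents \<open>r\<close> and \<open>r / (r - 1)\<close>. Multiplied by
    \<open>r\<close>, it says that \<open>y powr r\<close> lies above its tangent line at
    \<open>y = M\<close>.\<close>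
  have tangent: "y * M powr (r - 1) \<le> y powr r / r + M powr r * (1 - 1 / r)" if "0 \<le> y" for y
  proof -
    have "y * M powr (r - 1) \<le> y powr r / r + (M powr (r - 1)) powr (r / (r - 1)) / (r / (r - 1))"
      using r that by (intro Youngs_inequality) (auto simp: field_simps)
    also have "(M powr (r - 1)) powr (r / (r - 1)) = M powr r"
      using r by (simp add: powr_powr)
    also have "M powr r / (r / (r - 1)) = M powr r * (1 - 1 / r)"
      using r by (simp add: field_simps)
    finally show ?thesis .
  qed
  have "(\<Sum>k\<in>S. a k * w k) = W * M"
    using \<open>0 < W\<close> by (simp add: M_def)
  then have "W * (M * M powr (r - 1)) = (\<Sum>k\<in>S. a k * w k) * M powr (r - 1)"
    by simp
  also have "\<dots> = (\<Sum>k\<in>S. a k * M powr (r - 1) * w k)"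
    by (simp add: sum_distrib_left mult_ac)
  also have "\<dots> \<le> (\<Sum>k\<in>S. (a k powr r / r + M powr r * (1 - 1 / r)) * w k)"
    using a w by (intro sum_mono mult_right_mono tangent) auto
  also have "\<dots> = (\<Sum>k\<in>S. a k powr r * w k) / r + M powr r * (1 - 1 / r) * W"
    by (simp add: W_def distrib_right sum.distrib sum_distrib_left sum_divide_distrib)
  finally have "W * (M * M powr (r - 1)) \<le>
      (\<Sum>k\<in>S. a k powr r * w k) / r + M powr r * (1 - 1 / r) * W" .
  \<comment> \<open>At \<open>M = 0\<close> both sides vanish, because \<open>0 powr r = 0\<close>.
    Substituting this identity lets the term \<open>M powr r * W\<close> cancel, up to the fraction
    \<open>1 / r\<close> of it.\<close>
  moreover have "M * M powr (r - 1) = M powr r"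
    using \<open>0 \<le> M\<close> r by (cases "M = 0") (auto simp: powr_diff)
  ultimately have "W * M powr r / r \<le> (\<Sum>k\<in>S. a k powr r * w k) / r"
    by (simp add: algebra_simps)
  then have "W * M powr r \<le> (\<Sum>k\<in>S. a k powr r * w k)"
    using r by (simp add: divide_le_cancel)
  then show ?thesis by (simp add: W_def M_def)
qed

text \<open>One termwise bound settles both membership and the norm estimate, as the index set of
  the supremum is nonempty.\<close>

lemma morrey_space_norm_leI:
  assumes "\<And>m N. morrey_term p q \<omega> v x (m, N) \<le> B"
  shows "x \<in> morrey_space p q \<omega> v" and "morrey_norm p q \<omega> v x \<le> B"
proof -
  have "morrey_term p q \<omega> v x i \<le> B" for i
    using assms by (cases i) simp
  then show "x \<in> morrey_space p q \<omega> v" "morrey_norm p q \<omega> v x \<le> B"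
    by (auto simp: morrey_space_def morrey_norm_def intro!: bdd_aboveI cSUP_least)
qed

lemma morrey_infty_space_norm_leI:
  assumes "\<And>m N. morrey_infty_term p \<omega> x (m, N) \<le> B"
  shows "x \<in> morrey_infty_space p \<omega>" and "morrey_infty_norm p \<omega> x \<le> B"
proof -
  have "morrey_infty_term p \<omega> x i \<le> B" for i
    using assms by (cases i) simp
  then show "x \<in> morrey_infty_space p \<omega>" "morrey_infty_norm p \<omega> x \<le> B"
    by (auto simp: morrey_infty_space_def morrey_infty_norm_def intro!: bdd_aboveI cSUP_least)
qed

text \<open>The one-sided comparison acts in the same direction on both factors: it enlarges the sum
  when \<open>\<omega>\<close> becomes \<open>v\<close>, and the nonpositive exponent reverses
  \<open>W / C \<le> V\<close>.\<close>

lemma morrey_term_swap_le: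
  assumes "discrete_weight \<omega>" "discrete_weight v" and p: "1 \<le> p" "p \<le> q"
    and C: "0 < C" "\<And>k. \<omega> k \<le> C * v k"
  shows "morrey_term p q \<omega> v x (m, N) \<le> C powr (2 / p - 1 / q) * morrey_term p q v \<omega> x (m, N)"
proof -
  define V W where "V = (\<Sum>k\<in>sym_interval m N. v k)" and "W = (\<Sum>k\<in>sym_interval m N. \<omega> k)"
  define A B where "A = (\<Sum>k\<in>sym_interval m N. \<bar>x k\<bar> powr p * \<omega> k)"
    and "B = (\<Sum>k\<in>sym_interval m N. \<bar>x k\<bar> powr p * v k)"
  have "0 < V" "0 < W"
    using assms by (auto simp: V_def W_def discrete_weight_sum_pos)
  have "0 \<le> A" "0 \<le> B"
    using assms by (auto simp: A_def B_def weighted_sum_nonneg)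
  have "W \<le> C * V"
    unfolding W_def V_def sum_distrib_left using C by (intro sum_mono) auto
  have "A \<le> (\<Sum>k\<in>sym_interval m N. \<bar>x k\<bar> powr p * (C * v k))"
    unfolding A_def using C by (intro sum_mono mult_left_mono) auto
  then have "A \<le> C * B"
    by (simp add: B_def sum_distrib_left mult_ac)
  have "1 / q - 1 / p \<le> 0"
    using p by (simp add: field_simps)
  moreover have "W / C \<le> V"
    using \<open>W \<le> C * V\<close> \<open>0 < C\<close> by (simp add: field_simps)
  ultimately have "V powr (1 / q - 1 / p) \<le> (W / C) powr (1 / q - 1 / p)"
    using \<open>0 < W\<close> \<open>0 < C\<close> by (intro powr_mono2') auto
  moreover have "A powr (1 / p) \<le> (C * B) powr (1 / p)"
    using p \<open>0 \<le> A\<close> \<open>A \<le> C * B\<close> by (intro powr_mono2) auto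
  ultimately have "V powr (1 / q - 1 / p) * A powr (1 / p)
      \<le> (W / C) powr (1 / q - 1 / p) * (C * B) powr (1 / p)"
    by (intro mult_mono) auto
  also have "\<dots> = (C powr (1 / p) / C powr (1 / q - 1 / p)) * (W powr (1 / q - 1 / p) * B powr (1 / p))"
    using \<open>0 < W\<close> \<open>0 < C\<close> \<open>0 \<le> B\<close> by (simp add: powr_divide powr_mult)
  \<comment> \<open>The exponents combine as \<open>1/p - (1/q - 1/p) = 2/p - 1/q\<close>.\<close>
  also have "C powr (1 / p) / C powr (1 / q - 1 / p) = C powr (2 / p - 1 / q)"
    by (simp flip: powr_diff add: algebra_simps)
  finally show ?thesis
    by (simp add: morrey_term_def V_def W_def A_def B_def)
qed

lemma abs_le_linfty_norm:
  assumes "x \<in> linfty_space"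
  shows "\<bar>x k\<bar> \<le> linfty_norm x"
proof -
  have "bdd_above (range (\<lambda>k. \<bar>x k\<bar>))"
    using assms by (auto simp: linfty_space_def bounded_iff bdd_above_def)
  then show ?thesis
    unfolding linfty_norm_def by (intro cSUP_upper) auto
qed

text \<open>The term is a weighted \<open>p\<close>-mean of the values
  \<open>\<bar>x k\<bar>\<close> and so cannot exceed their supremum.\<close>

lemma morrey_infty_term_le:
  assumes "discrete_weight \<omega>" "1 \<le> p" "x \<in> linfty_space"
  shows "morrey_infty_term p \<omega> x (m, N) \<le> linfty_norm x"
proof -
  define L where "L = linfty_norm x"
  define W A where "W = (\<Sum>k\<in>sym_interval m N. \<omega> k)"
    and "A = (\<Sum>k\<in>sym_interval m N. \<bar>x k\<bar> powr p * \<omega> k)"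
  have L: "\<bar>x k\<bar> \<le> L" for k
    using assms by (simp add: L_def abs_le_linfty_norm)
  then have "0 \<le> L" using abs_ge_zero order_trans by blast
  have "0 < W" "0 \<le> A"
    using assms by (auto simp: W_def A_def discrete_weight_sum_pos weighted_sum_nonneg)
  have "A \<le> L powr p * W"
    unfolding A_def W_def sum_distrib_left
    using assms L by (intro sum_mono mult_right_mono powr_mono2)
      (auto simp: discrete_weight_def less_imp_le)
  then have "A powr (1 / p) \<le> (L powr p * W) powr (1 / p)"
    using \<open>0 \<le> A\<close> assms by (intro powr_mono2) auto
  \<comment> \<open>Nonnegativity of \<open>L\<close> is what turns
    \<open>(L powr p) powr (1 / p)\<close> back into \<open>L\<close>.\<close>
  also have "\<dots> = L * W powr (1 / p)"
    using assms \<open>0 \<le> L\<close> \<open>0 < W\<close> by (simp add: powr_mult powr_powr)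
  finally have "W powr (- 1 / p) * A powr (1 / p) \<le> W powr (- 1 / p) * (L * W powr (1 / p))"
    by (intro mult_left_mono) auto
  also have "\<dots> = L"
    using \<open>0 < W\<close> by (simp add: powr_minus field_simps)
  finally show ?thesis
    by (simp add: morrey_infty_term_def W_def A_def L_def)
qed

text \<open>The power mean inequality is applied to \<open>\<bar>x k\<bar> powr p\<close> with
  exponent \<open>q / p\<close>, which exceeds 1 as \<open>p < q\<close>. A root of order
  \<open>q\<close> then gives the claim.\<close>

lemma morrey_term_le_lq_norm:
  assumes "discrete_weight \<omega>" and p: "1 \<le> p" "p < q" and x: "x \<in> lq_space q \<omega>"
  shows "morrey_term p q \<omega> \<omega> x (m, N) \<le> lq_norm q \<omega> x"
proof -
  define W A where "W = (\<Sum>k\<in>sym_interval m N. \<omega> k)"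
    and "A = (\<Sum>k\<in>sym_interval m N. \<bar>x k\<bar> powr p * \<omega> k)"
  have \<omega>: "0 \<le> \<omega> k" for k
    using assms by (simp add: discrete_weight_def less_imp_le)
  have "0 < W" "0 \<le> A"
    using assms by (auto simp: W_def A_def discrete_weight_sum_pos weighted_sum_nonneg)
  have "W * (A / W) powr (q / p) \<le> (\<Sum>k\<in>sym_interval m N. (\<bar>x k\<bar> powr p) powr (q / p) * \<omega> k)"
    unfolding W_def A_def
    using p \<omega> assms(1) by (intro weighted_power_mean) (auto simp: discrete_weight_sum_pos)
  also have "\<dots> = (\<Sum>k\<in>sym_interval m N. \<bar>x k\<bar> powr q * \<omega> k)"
    using p by (simp add: powr_powr)
  \<comment> \<open>Membership in \<open>lq_space\<close> supplies the summability; without it the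
    infinite sum would default to 0 and bound nothing.\<close>
  also have "\<dots> \<le> (\<Sum>\<^sub>\<infinity>k. \<bar>x k\<bar> powr q * \<omega> k)"
    using x \<omega> by (intro finite_sum_le_infsum) (auto simp: lq_space_def)
  finally have "(W * (A / W) powr (q / p)) powr (1 / q) \<le> lq_norm q \<omega> x"
    unfolding lq_norm_def using p \<open>0 < W\<close> by (intro powr_mono2) auto
  \<comment> \<open>Since \<open>(q/p) * (1/q) = 1/p\<close>, the left side is
    \<open>W powr (1/q) * (A / W) powr (1/p)\<close>.\<close>
  moreover have "(W * (A / W) powr (q / p)) powr (1 / q) = W powr (1 / q - 1 / p) * A powr (1 / p)"
    using p \<open>0 < W\<close> \<open>0 \<le> A\<close> by (simp add: powr_mult powr_powr powr_divide powr_diff)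
  ultimately show ?thesis
    by (simp add: morrey_term_def W_def A_def)
qed

theorem proposition2p4:
  fixes \<omega> v :: "int \<Rightarrow> real"
  assumes "discrete_weight \<omega>" and "discrete_weight v"
  shows
    "(\<forall>p q :: real. 1 \<le> p \<and> p \<le> q \<and> (\<exists>C>0. \<forall>k. \<omega> k \<le> C * v k) \<longrightarrow>
        morrey_space p q v \<omega> \<subseteq> morrey_space p q \<omega> v \<and>
        (\<exists>C'>0. \<forall>x\<in>morrey_space p q v \<omega>.
           morrey_norm p q \<omega> v x \<le> C' * morrey_norm p q v \<omega> x)) \<and>
     (\<forall>p :: real. 1 \<le> p \<longrightarrow>
        linfty_space \<subseteq> morrey_infty_space p \<omega> \<and>
        (\<forall>x\<in>linfty_space. morrey_infty_norm p \<omega> x \<le> linfty_norm x)) \<and>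
     (\<forall>p q :: real. 1 < p \<and> p < q \<longrightarrow>
        lq_space q \<omega> \<subseteq> morrey_space p q \<omega> \<omega> \<and>
        (\<forall>x\<in>lq_space q \<omega>. morrey_norm p q \<omega> \<omega> x \<le> lq_norm q \<omega> x))"
proof (intro conjI allI impI)
  fix p q :: real
  assume "1 \<le> p \<and> p \<le> q \<and> (\<exists>C>0. \<forall>k. \<omega> k \<le> C * v k)"
  then obtain C where p: "1 \<le> p" "p \<le> q" and C: "0 < C" "\<And>k. \<omega> k \<le> C * v k"
    by blast
  \<comment> \<open>The factor from the termwise estimate depends only on \<open>C\<close>,
    \<open>p\<close> and \<open>q\<close>, so it serves every \<open>x\<close>.\<close>
  define C' where "C' = C powr (2 / p - 1 / q)"
  have "0 < C'" using C by (simp add: C'_def)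
  have le: "morrey_term p q \<omega> v x (m, N) \<le> C' * morrey_norm p q v \<omega> x"
    if "x \<in> morrey_space p q v \<omega>" for x m N
  proof -
    \<comment> \<open>Membership gives boundedness above, so the real supremum really dominates each
      term.\<close>
    have "morrey_term p q v \<omega> x (m, N) \<le> morrey_norm p q v \<omega> x"
      using that unfolding morrey_norm_def morrey_space_def by (intro cSUP_upper) auto
    then have "C' * morrey_term p q v \<omega> x (m, N) \<le> C' * morrey_norm p q v \<omega> x"
      using \<open>0 < C'\<close> by simp
    with morrey_term_swap_le[OF assms p C] show ?thesis
      unfolding C'_def by (rule order_trans)
  qed
  show "morrey_space p q v \<omega> \<subseteq> morrey_space p q \<omega> v"
    using le by (blast intro: morrey_space_norm_leI(1))
  show "\<exists>C'>0. \<forall>x\<in>morrey_space p q v \<omega>. morrey_norm p q \<omega> v x \<le> C' * morrey_norm p q v \<omega> x"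
    using \<open>0 < C'\<close> le by (blast intro: morrey_space_norm_leI(2))
next
  fix p :: real
  assume "1 \<le> p"
  note le = morrey_infty_term_le[OF assms(1) this]
  show "linfty_space \<subseteq> morrey_infty_space p \<omega>"
    using le by (blast intro: morrey_infty_space_norm_leI(1))
  show "\<forall>x\<in>linfty_space. morrey_infty_norm p \<omega> x \<le> linfty_norm x"
    using le by (blast intro: morrey_infty_space_norm_leI(2))
next
  fix p q :: real
  assume "1 < p \<and> p < q"
  then have le: "morrey_term p q \<omega> \<omega> x (m, N) \<le> lq_norm q \<omega> x" if "x \<in> lq_space q \<omega>" for x m N
    using assms(1) that by (intro morrey_term_le_lq_norm) auto
  show "lq_space q \<omega> \<subseteq> morrey_space p q \<omega> \<omega>"
    using le by (blast intro: morrey_space_norm_leI(1))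
  show "\<forall>x\<in>lq_space q \<omega>. morrey_norm p q \<omega> \<omega> x \<le> lq_norm q \<omega> x"
    using le by (blast intro: morrey_space_norm_leI(2))
qed

end
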